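(* Let $\mathcal{F}_0=\{f_1,\ldots,f_M\}$ be a finite subset of $M$ elements of $\mathcal{F}$, where $M\geq 2$ is an integer. Assume that the underlying probability measure $\pi$ satisfies the margin assumption MA($\kappa,c,\mathcal{F}_0$) for some $\kappa\geq 1$, $c>0$, and that $|Q(Z,f)-Q(Z,f^* )|\leq K$ almost surely for every $f\in\mathcal{F}_0$, where $K\geq 1$ is a constant. Then the Empirical Risk Minimization procedure $\tilde f_n^{(ERM)}$ over $\mathcal{F}_0$ satisfies $$\mathbb{E}\big[A(\tilde f_n^{(ERM)})-A^*\big]\leq \min_{j=1,\ldots,M}\big(A(f_j)-A^*\big)+4\gamma(n,M,\kappa,\mathcal{F}_0,\pi,Q).$$ Moreover, if $f\longmapsto Q(z,f)$ is convex for $\pi$-almost every $z\in\mathcal{Z}$, then the aggregate with exponential weights $\tilde f_n^{(AEW)}$ over $\mathcal{F}_0$ satisfies the same inequality, i.e. $$\mathbb{E}\big[A(\tilde f_n^{(AEW)})-A^*\big]\leq \min_{j=1,\ldots,M}\big(A(f_j)-A^*\big)+4\gamma(n,M,\kappa,\mathcal{F}_0,\pi,Q).$$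
   Context: Framework. $(\mathcal{Z},\mathcal{T})$ is a measurable space, $Z$ is a random variable with values in $\mathcal{Z}$ and probability distribution $\pi$, and $D_n=(Z_1,\ldots,Z_n)$, $n\geq1$, are i.i.d. observations with common distribution $\pi$. $\mathcal{F}$ is an algebra (so that convex combinations of its elements make sense), and $Q:\mathcal{Z}\times\mathcal{F}\to\mathbb{R}$ is a loss function. The risk of $f\in\mathcal{F}$ is $A(f)=\mathbb{E}[Q(Z,f)]$, and $A^*=\min_{f\in\mathcal{F}}A(f)$ is assumed to be achieved; $f^*$ denotes a minimizer of $A$ in $\mathcal{F}$. The empirical risk is $A_n(f)=\frac1n\sum_{i=1}^nQ(Z_i,f)$. For a data-dependent element $\tilde f_n$ of $\mathcal{F}$, $A(\tilde f_n)$ denotes the function $A$ evaluated at $\tilde f_n$ (a random variable depending on $D_n$), and $\mathbb{E}[A(\tilde f_n)-A^*]$ is the expectation over $D_n$. Margin assumption MA($\kappa,c,\mathcal{F}_0$) (with $\kappa\ge1$, $c>0$, $\mathcal{F}_0\subseteq\mathcal{F}$): $\mathbb{E}[(Q(Z,f)-Q(Z,f^* ))^2]\leq c\,(A(f)-A^* )^{1/\kappa}$ for every $f\in\mathcal{F}_0$. Procedures over $\mathcal{F}_0$: $\tilde f_n^{(ERM)}\in\arg\min_{f\in\mathcal{F}_0}A_n(f)$, and $$\tilde f_n^{(AEW)}=\sum_{f\in\mathcal{F}_0}w^{(n)}(f)f,\qquad w^{(n)}(f)=\frac{\exp(-nA_n(f))}{\sum_{g\in\mathcal{F}_0}\exp(-nA_n(g))}.$$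 Residual term: with $\mathcal{B}=\mathcal{B}(\mathcal{F}_0,\pi,Q)=\min_{f\in\mathcal{F}_0}(A(f)-A^* )$, $$\gamma(n,M,\kappa,\mathcal{F}_0,\pi,Q)=\begin{cases}\left(\dfrac{\mathcal{B}^{1/\kappa}\log M}{\beta_1 n}\right)^{1/2}&\text{if }\mathcal{B}\geq\left(\dfrac{\log M}{\beta_1 n}\right)^{\frac{\kappa}{2\kappa-1}},\\[2mm]\left(\dfrac{\log M}{\beta_2 n}\right)^{\frac{\kappa}{2\kappa-1}}&\text{otherwise,}\end{cases}$$ where $$\beta_1=\min\Big(\frac{\log2}{96cK},\frac{3\sqrt{\log2}}{16K\sqrt2},\frac{1}{8(4c+K/3)},\frac{1}{576c}\Big),\qquad \beta_2=\min\Big(\frac18,\frac{3\log2}{32K},\frac{1}{2(16c+K/3)},\frac{\beta_1}{2}\Big).$$ *)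

theory Defs
  imports "HOL-Probability.Probability"
begin

text \<open>
  The class \<open>\<F>\<close> of the text is a set \<open>F\<close> closed under the operations of an ambient real algebra.
  A sample is a function \<open>d\<close> whose values at \<open>1, \<dots>, n\<close> are the observations.
\<close>

definition risk :: "'z measure \<Rightarrow> ('z \<Rightarrow> 'f \<Rightarrow> real) \<Rightarrow> 'f \<Rightarrow> real" where
  "risk \<pi> Q f = (\<integral>z. Q z f \<partial>\<pi>)"

text \<open>
  \<open>has_risk\<close> says that the expectation of the loss of \<open>f\<close> exists in \<open>(-\<infinity>, \<infinity>]\<close>. It is finite, and
  equal to \<^const>\<open>risk\<close>, exactly when the loss is integrable. Elements of infinite risk cannot be
  minimizers, and they are left out of the comparison in \<open>risk_minimizer\<close> because the Bochner
  integral would assign them the value \<open>0\<close>.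
\<close>

definition has_risk :: "'z measure \<Rightarrow> ('z \<Rightarrow> 'f \<Rightarrow> real) \<Rightarrow> 'f \<Rightarrow> bool" where
  "has_risk \<pi> Q f \<longleftrightarrow>
     (\<lambda>z. Q z f) \<in> borel_measurable \<pi> \<and> integrable \<pi> (\<lambda>z. max 0 (- Q z f))"

definition risk_minimizer :: "'z measure \<Rightarrow> ('z \<Rightarrow> 'f \<Rightarrow> real) \<Rightarrow> 'f set \<Rightarrow> 'f \<Rightarrow> bool" where
  "risk_minimizer \<pi> Q F fstar \<longleftrightarrow>
     is_arg_min (risk \<pi> Q) (\<lambda>f. f \<in> F \<and> integrable \<pi> (\<lambda>z. Q z f)) fstar"

definition excess_risk :: "'z measure \<Rightarrow> ('z \<Rightarrow> 'f \<Rightarrow> real) \<Rightarrow> 'f \<Rightarrow> 'f \<Rightarrow> real" where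
  "excess_risk \<pi> Q fstar f = risk \<pi> Q f - risk \<pi> Q fstar"

definition margin_assumption ::
    "'z measure \<Rightarrow> ('z \<Rightarrow> 'f \<Rightarrow> real) \<Rightarrow> 'f \<Rightarrow> real \<Rightarrow> real \<Rightarrow> 'f set \<Rightarrow> bool" where
  "margin_assumption \<pi> Q fstar \<kappa> c F0 \<longleftrightarrow>
     (\<forall>f\<in>F0. integrable \<pi> (\<lambda>z. (Q z f - Q z fstar)\<^sup>2) \<and>
             (\<integral>z. (Q z f - Q z fstar)\<^sup>2 \<partial>\<pi>) \<le> c * excess_risk \<pi> Q fstar f powr (1 / \<kappa>))"

definition empirical_risk :: "('z \<Rightarrow> 'f \<Rightarrow> real) \<Rightarrow> nat \<Rightarrow> (nat \<Rightarrow> 'z) \<Rightarrow> 'f \<Rightarrow> real" where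
  "empirical_risk Q n d f = (1 / real n) * (\<Sum>i=1..n. Q (d i) f)"

definition is_erm :: "('z \<Rightarrow> 'f \<Rightarrow> real) \<Rightarrow> nat \<Rightarrow> 'f set \<Rightarrow> (nat \<Rightarrow> 'z) \<Rightarrow> 'f \<Rightarrow> bool" where
  "is_erm Q n F0 d g \<longleftrightarrow> is_arg_min (empirical_risk Q n d) (\<lambda>f. f \<in> F0) g"

definition aew_weight :: "('z \<Rightarrow> 'f \<Rightarrow> real) \<Rightarrow> nat \<Rightarrow> 'f set \<Rightarrow> (nat \<Rightarrow> 'z) \<Rightarrow> 'f \<Rightarrow> real" where
  "aew_weight Q n F0 d f =
     exp (- real n * empirical_risk Q n d f) / (\<Sum>g\<in>F0. exp (- real n * empirical_risk Q n d g))"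

definition aew ::
    "('z \<Rightarrow> 'f \<Rightarrow> real) \<Rightarrow> nat \<Rightarrow> 'f set \<Rightarrow> (nat \<Rightarrow> 'z) \<Rightarrow> 'f :: real_vector" where
  "aew Q n F0 d = (\<Sum>f\<in>F0. aew_weight Q n F0 d f *\<^sub>R f)"

definition min_excess_risk :: "'z measure \<Rightarrow> ('z \<Rightarrow> 'f \<Rightarrow> real) \<Rightarrow> 'f \<Rightarrow> 'f set \<Rightarrow> real" where
  "min_excess_risk \<pi> Q fstar F0 = Min (excess_risk \<pi> Q fstar ` F0)"

definition beta1 :: "real \<Rightarrow> real \<Rightarrow> real" where
  "beta1 c K = Min {ln 2 / (96 * c * K), 3 * sqrt (ln 2) / (16 * K * sqrt 2),
                    1 / (8 * (4 * c + K / 3)), 1 / (576 * c)}"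

definition beta2 :: "real \<Rightarrow> real \<Rightarrow> real" where
  "beta2 c K = Min {1 / 8, 3 * ln 2 / (32 * K), 1 / (2 * (16 * c + K / 3)), beta1 c K / 2}"

text \<open>
  The constants \<open>c\<close> and \<open>K\<close>, on which the residual depends through \<^const>\<open>beta1\<close> and
  \<^const>\<open>beta2\<close>, are explicit arguments. The minimizer \<open>fstar\<close> enters only through its risk.
\<close>

definition residual ::
    "real \<Rightarrow> real \<Rightarrow> nat \<Rightarrow> nat \<Rightarrow> real \<Rightarrow> 'f set \<Rightarrow> 'z measure \<Rightarrow> ('z \<Rightarrow> 'f \<Rightarrow> real) \<Rightarrow> 'f \<Rightarrow> real" where
  "residual c K n M \<kappa> F0 \<pi> Q fstar =
     (let B = min_excess_risk \<pi> Q fstar F0 in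
      if B \<ge> (ln (real M) / (beta1 c K * real n)) powr (\<kappa> / (2 * \<kappa> - 1))
      then (B powr (1 / \<kappa>) * ln (real M) / (beta1 c K * real n)) powr (1 / 2)
      else (ln (real M) / (beta2 c K * real n)) powr (\<kappa> / (2 * \<kappa> - 1)))"

end

theory Submission
  imports Defs
begin

text \<open>
  Write \<open>R f\<close> for the excess risk, \<open>D f\<close> for the empirical excess risk over the sample and
  \<open>L = ln M / n\<close>. Both procedures are averages over \<open>F0\<close> with data-dependent weights \<open>w\<close> such that
  \<open>\<Sum>f. w f * D f \<le> D g + L\<close> for every \<open>g\<close> in \<open>F0\<close>. For empirical risk minimization \<open>w\<close> is a point mass and
  the inequality holds even without \<open>L\<close>. For exponential weights it is the entropy bound
  \<open>gibbs_average_le\<close>, and convexity bounds the risk of the aggregate by \<open>\<Sum>f. w f * R f\<close>. Taking for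
  \<open>g\<close> the best element of \<open>F0\<close>, whose \<open>D g\<close> has mean \<open>B = min R\<close>, it remains to bound the mean of
  \<open>\<Sum>f. w f * (R f - D f)\<close>.

  For \<open>0 < l \<le> 1 / K\<close> the inequality \<open>exp x \<le> 1 + x + x\<^sup>2\<close> on \<open>x \<le> 1\<close> and independence give
  \<open>E (exp (n l (R f - D f) - n l\<^sup>2 v f)) \<le> 1\<close>, where \<open>v f\<close> bounds the second moment of the loss difference.
  By the margin assumption one may take \<open>v f = c * G powr (1 / \<kappa>) * (1 + R f / G)\<close>, for any \<open>G > 0\<close>. A
  weighted average is at most the log-sum-exp, whose mean is at most \<open>ln M\<close>; so all candidates are
  controlled at once, whatever the size of their risk. With \<open>V = c * G powr (1 / \<kappa>)\<close> and \<open>G \<ge> B\<close> the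
  expected excess risk \<open>e\<close> satisfies \<open>e * (1 - l V / G) \<le> B + 2 L / l + l V\<close> as long as \<open>l V \<le> G / 2\<close>; this
  is the main step in the proof of \<open>randomized_selection_bound\<close>.

  Finally \<open>G\<close> and \<open>l\<close> are chosen. In the first branch of the residual \<open>\<gamma>\<close> one takes \<open>G = B\<close>, in the second
  \<open>G = \<gamma>\<close>, and in both \<open>l = min (\<gamma> / (2 V)) (1 / K)\<close>; the definitions of \<open>\<beta>\<^sub>1\<close> and \<open>\<beta>\<^sub>2\<close> make the last
  two terms small enough, unless \<open>\<gamma>\<close> is so large that it bounds every \<open>R f\<close>, to give
  \<open>e \<le> B + 4 \<gamma>\<close> (\<open>excess_le_four_rate\<close>, \<open>excess_le_residual\<close>).

  One point is specific to exponential weights: that the risk of the aggregate is a random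
  variable. The class has no topology, but the risk is a convex function of the mixture, and such a
  function depends continuously on the weights as long as they are all positive
  (\<open>borel_measurable_convex_on_combination\<close>).
\<close>

section \<open>Gibbs weights and exponential moments\<close>

lemma exp_le_quadratic:
  fixes x :: real
  assumes "x \<le> 1"
  shows "exp x \<le> 1 + x + x\<^sup>2"
proof (cases "0 \<le> x")
  case True
  with assms show ?thesis by (intro exp_bound)
next
  case False
  define y where "y = - x"
  have y: "y > 0" using False by (simp add: y_def)
  have "1 \<le> 1 + y\<^sup>2 / 2 + y^3 / 2 + y^4 / 2" using y by simp
  also have "\<dots> = (1 - y + y\<^sup>2) * (1 + y + y\<^sup>2 / 2)"
    by (simp add: field_simps power2_eq_square power3_eq_cube power4_eq_xxxx)
  also have "\<dots> \<le> (1 - y + y\<^sup>2) * exp y"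
  proof (intro mult_left_mono exp_lower_Taylor_quadratic)
    have "1 - y + y\<^sup>2 = (y - 1/2)\<^sup>2 + 3/4" by (simp add: power2_eq_square field_simps)
    then show "0 \<le> 1 - y + y\<^sup>2" by simp
  qed (use y in simp)
  finally have "exp (- y) \<le> 1 - y + y\<^sup>2" by (simp add: exp_minus field_simps)
  then show ?thesis by (simp add: y_def)
qed

text \<open>
  The tangent of \<open>ln\<close> at \<open>m\<close>. Taking expectations of this pointwise bound gives Jensen's inequality
  \<open>E (ln s) \<le> ln m\<close> whenever \<open>E s \<le> m\<close>.
\<close>
lemma ln_le_linear:
  fixes s m :: real
  assumes "s > 0" "m > 0"
  shows "ln s \<le> ln m + s / m - 1"
  using ln_le_minus_one[of "s / m"] assms by (simp add: ln_div)

text \<open>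
  An average is at most the maximum, and the maximum at most the log-sum-exp. The right-hand side
  is independent of \<open>w\<close>, so the weights may depend on the data in any way.
\<close>
lemma weighted_sum_le_ln_sum_exp:
  fixes w Z :: "'a \<Rightarrow> real"
  assumes fin: "finite S" and w: "\<And>f. f \<in> S \<Longrightarrow> 0 \<le> w f" "sum w S = 1"
  shows "(\<Sum>f\<in>S. w f * Z f) \<le> ln (\<Sum>f\<in>S. exp (Z f))"
proof -
  have ne: "S \<noteq> {}" using w by auto
  have pos: "(\<Sum>f\<in>S. exp (Z f)) > 0" using fin ne by (intro sum_pos) auto
  have "Z f \<le> ln (\<Sum>f\<in>S. exp (Z f))" if "f \<in> S" for f
  proof -
    have "exp (Z f) \<le> (\<Sum>f\<in>S. exp (Z f))" using that fin by (intro member_le_sum) auto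
    then show ?thesis using pos by (simp add: ln_ge_iff)
  qed
  then have "(\<Sum>f\<in>S. w f * Z f) \<le> (\<Sum>f\<in>S. w f * ln (\<Sum>f\<in>S. exp (Z f)))"
    using w by (intro sum_mono mult_left_mono) auto
  then show ?thesis using w by (simp flip: sum_distrib_right)
qed

text \<open>
  Solving \<open>w f = exp (- r f) / N\<close> for \<open>r f\<close> shows that the average of \<open>r\<close> under the Gibbs weights is
  their entropy minus \<open>ln N\<close>, where \<open>N\<close> is the normalizing sum. The entropy is at most
  \<open>ln (card S)\<close>, and \<open>- ln N\<close> is at most every \<open>r g\<close>, since \<open>exp (- r g)\<close> is one of the summands of \<open>N\<close>.
\<close>
lemma gibbs_average_le:
  fixes r :: "'a \<Rightarrow> real"
  assumes fin: "finite S" and g: "g \<in> S"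
  shows "(\<Sum>f\<in>S. exp (- r f) / (\<Sum>h\<in>S. exp (- r h)) * r f) \<le> r g + ln (card S)"
proof -
  define N where "N = (\<Sum>h\<in>S. exp (- r h))"
  define w where "w f = exp (- r f) / N" for f
  have cS: "card S > 0" using assms by (auto simp: card_gt_0_iff)
  have N: "N > 0" unfolding N_def using assms by (intro sum_pos) auto
  have w: "w f > 0" for f using N by (simp add: w_def)
  have sw: "sum w S = 1" using N by (simp add: w_def N_def flip: sum_divide_distrib)
  have lnw: "ln (w f) = - r f - ln N" for f using N by (simp add: w_def ln_div)
  (* The entropy bound term by term: ln x <= x - 1 at x = 1 / (card S * w f). *)
  have "w f * (r f + ln N - ln (card S)) \<le> 1 / card S - w f" for f
  proof -
    have "w f * ln (1 / (card S * w f)) \<le> w f * (1 / (card S * w f) - 1)"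
      using w[of f] cS by (intro mult_left_mono ln_le_minus_one) auto
    also have "\<dots> = 1 / card S - w f" using w[of f] cS by (simp add: field_simps)
    finally show ?thesis using w[of f] cS lnw[of f] by (simp add: ln_div ln_mult algebra_simps)
  qed
  then have "(\<Sum>f\<in>S. w f * (r f + ln N - ln (card S))) \<le> (\<Sum>f\<in>S. 1 / card S - w f)"
    by (intro sum_mono)
  also have "\<dots> = 0" using sw cS by (simp add: sum_subtractf)
  also have "(\<Sum>f\<in>S. w f * (r f + ln N - ln (card S)))
      = (\<Sum>f\<in>S. w f * r f) + sum w S * (ln N - ln (card S))"
    by (simp add: algebra_simps sum.distrib sum_subtractf sum_distrib_left sum_distrib_right)
  finally have "(\<Sum>f\<in>S. w f * r f) + ln N - ln (card S) \<le> 0"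
    using sw by simp
  moreover have "- r g \<le> ln N"
  proof -
    have "exp (- r g) \<le> N" unfolding N_def using assms by (intro member_le_sum) auto
    then show ?thesis using N by (simp add: ln_ge_iff)
  qed
  ultimately show ?thesis by (simp add: w_def N_def)
qed

text \<open>
  The second-order term carries the second moment of \<open>Y\<close> and not its range. This is what lets
  the margin assumption enter the moment bound; a bound of Hoeffding type would not see it.
\<close>
lemma (in prob_space) exp_moment_bounded:
  fixes Y :: "'a \<Rightarrow> real"
  assumes Y: "Y \<in> borel_measurable M" and bd: "AE x in M. \<bar>Y x\<bar> \<le> K"
    and l: "0 \<le> l" "l * K \<le> 1"
  shows "integrable M (\<lambda>x. exp (- l * Y x))"
    and "expectation (\<lambda>x. exp (- l * Y x))
      \<le> exp (- l * expectation Y + l\<^sup>2 * expectation (\<lambda>x. (Y x)\<^sup>2))"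
proof -
  have small: "AE x in M. \<bar>l * Y x\<bar> \<le> 1"
    using bd
  proof eventually_elim
    case (elim x)
    then have "l * \<bar>Y x\<bar> \<le> l * K" using l by (intro mult_left_mono)
    then show ?case using l by (simp add: abs_mult)
  qed
  have int: "integrable M Y"
    using bd Y by (intro integrable_const_bound[where B = K]) auto
  have int2: "integrable M (\<lambda>x. (Y x)\<^sup>2)"
  proof (rule integrable_const_bound[where B = "K\<^sup>2"])
    show "AE x in M. norm ((Y x)\<^sup>2) \<le> K\<^sup>2"
      using bd by eventually_elim (simp add: abs_le_square_iff[symmetric])
  qed (use Y in measurable)
  show inte: "integrable M (\<lambda>x. exp (- l * Y x))"
  proof (rule integrable_const_bound[where B = "exp 1"])
    show "AE x in M. norm (exp (- l * Y x)) \<le> exp 1"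
      using small by eventually_elim auto
  qed (use Y in measurable)
  have "expectation (\<lambda>x. exp (- l * Y x)) \<le> expectation (\<lambda>x. 1 + (- l * Y x + l\<^sup>2 * (Y x)\<^sup>2))"
  proof (rule integral_mono_AE[OF inte])
    show "AE x in M. exp (- l * Y x) \<le> 1 + (- l * Y x + l\<^sup>2 * (Y x)\<^sup>2)"
      using small
    proof eventually_elim
      case (elim x)
      then have "- l * Y x \<le> 1" by (simp add: abs_le_iff)
      from exp_le_quadratic[OF this] show ?case by (simp add: power_mult_distrib algebra_simps)
    qed
  qed (use int int2 in simp)
  also have "\<dots> = 1 + (- l * expectation Y + l\<^sup>2 * expectation (\<lambda>x. (Y x)\<^sup>2))"
    using int int2 by (simp add: prob_space)
  also have "\<dots> \<le> exp (- l * expectation Y + l\<^sup>2 * expectation (\<lambda>x. (Y x)\<^sup>2))"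
    by (rule exp_ge_add_one_self)
  finally show "expectation (\<lambda>x. exp (- l * Y x))
      \<le> exp (- l * expectation Y + l\<^sup>2 * expectation (\<lambda>x. (Y x)\<^sup>2))" .
qed

lemma (in prob_space) exp_moment_iid_sum:
  fixes Y :: "'b \<Rightarrow> real"
  assumes fin: "finite I"
    and indep: "indep_vars (\<lambda>_. N) X I"
    and dist: "\<And>i. i \<in> I \<Longrightarrow> distr M N (X i) = N"
    and N: "prob_space N"
    and Y: "Y \<in> borel_measurable N" and bd: "AE z in N. \<bar>Y z\<bar> \<le> K"
    and l: "0 \<le> l" "l * K \<le> 1"
  shows "integrable M (\<lambda>x. exp (- l * (\<Sum>i\<in>I. Y (X i x))))"
    and "expectation (\<lambda>x. exp (- l * (\<Sum>i\<in>I. Y (X i x))))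
      \<le> exp (card I * (- l * (\<integral>z. Y z \<partial>N) + l\<^sup>2 * (\<integral>z. (Y z)\<^sup>2 \<partial>N)))"
proof -
  interpret N: prob_space N by fact
  note mom = N.exp_moment_bounded[OF Y bd l]
  have X: "X i \<in> measurable M N" if "i \<in> I" for i
    using indep that by (auto simp: indep_vars_def)
  have gm: "(\<lambda>z. exp (- l * Y z)) \<in> borel_measurable N" using Y by measurable
  have ind: "indep_vars (\<lambda>_. borel) (\<lambda>i x. exp (- l * Y (X i x))) I"
    by (rule indep_vars_compose2[OF indep, where Y = "\<lambda>_ z. exp (- l * Y z)"]) (rule gm)
  have inti: "integrable M (\<lambda>x. exp (- l * Y (X i x)))" if "i \<in> I" for i
    using integrable_distr[OF X[OF that], of "\<lambda>z. exp (- l * Y z)"] mom(1) dist[OF that] by simp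
  have expi: "expectation (\<lambda>x. exp (- l * Y (X i x))) = (\<integral>z. exp (- l * Y z) \<partial>N)" if "i \<in> I" for i
    using integral_distr[OF X[OF that] gm] dist[OF that] by simp
  have eq: "exp (- l * (\<Sum>i\<in>I. Y (X i x))) = (\<Prod>i\<in>I. exp (- l * Y (X i x)))" for x
    using fin by (simp add: exp_sum sum_distrib_left flip: sum_negf)
  show "integrable M (\<lambda>x. exp (- l * (\<Sum>i\<in>I. Y (X i x))))"
    unfolding eq using indep_vars_integrable[OF fin ind inti] .
  have "expectation (\<lambda>x. exp (- l * (\<Sum>i\<in>I. Y (X i x))))
      = (\<Prod>i\<in>I. expectation (\<lambda>x. exp (- l * Y (X i x))))"
    unfolding eq using indep_vars_lebesgue_integral[OF fin ind inti] .
  also have "\<dots> = (\<integral>z. exp (- l * Y z) \<partial>N) ^ card I" by (simp only: expi prod_constant cong: prod.cong)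
  also have "\<dots> \<le> exp (- l * (\<integral>z. Y z \<partial>N) + l\<^sup>2 * (\<integral>z. (Y z)\<^sup>2 \<partial>N)) ^ card I"
    by (intro power_mono mom(2)) simp
  finally show "expectation (\<lambda>x. exp (- l * (\<Sum>i\<in>I. Y (X i x))))
      \<le> exp (card I * (- l * (\<integral>z. Y z \<partial>N) + l\<^sup>2 * (\<integral>z. (Y z)\<^sup>2 \<partial>N)))"
    by (simp only: exp_of_nat_mult)
qed

section \<open>Measurability of a convex function of random weights\<close>

text \<open>
  A convex function is continuous in barycentric coordinates at every point whose coordinates are
  all positive. If the coordinates \<open>v'\<close> dominate \<open>(1 - e) * v\<close>, then the point of \<open>v'\<close> is a mixture of
  the point of \<open>v\<close>, with weight \<open>1 - e\<close>, and of some point of the hull, where \<open>H\<close> is at most its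
  maximum over the vertices. Near a point with positive coordinates both dominations hold with
  small \<open>e\<close>, and they bound \<open>H\<close> from both sides. Convergence is that of the coordinates, since a
  real vector space comes without a topology.
\<close>
lemma convex_on_combination_tendsto:
  fixes H :: "'a :: real_vector \<Rightarrow> real"
  assumes fin: "finite S" and cvx: "convex_on (convex hull S) H"
    and w: "\<And>f. f \<in> S \<Longrightarrow> 0 < w f" "sum w S = 1"
    and u: "\<And>f. f \<in> S \<Longrightarrow> (\<lambda>k. u k f) \<longlonglongrightarrow> w f" "\<forall>\<^sub>F k in sequentially. sum (u k) S = 1"
  shows "(\<lambda>k. H (\<Sum>f\<in>S. u k f *\<^sub>R f)) \<longlonglongrightarrow> H (\<Sum>f\<in>S. w f *\<^sub>R f)"
proof -
  have ne: "S \<noteq> {}" using w by auto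
  define m where "m = Max (H ` S)"
  have hull: "(\<Sum>f\<in>S. v f *\<^sub>R f) \<in> convex hull S"
    if "\<And>f. f \<in> S \<Longrightarrow> 0 \<le> v f" "sum v S = 1" for v
    using that unfolding convex_hull_finite[OF fin] by auto
  have Hm: "H x \<le> m" if "x \<in> convex hull S" for x
    using convex_on_convex_hull_bound[OF cvx, of m] that fin by (auto simp: m_def)
  have dom: "H (\<Sum>f\<in>S. v' f *\<^sub>R f) \<le> (1 - e) * H (\<Sum>f\<in>S. v f *\<^sub>R f) + e * m"
    if v: "\<And>f. f \<in> S \<Longrightarrow> 0 \<le> v f" "sum v S = 1"
      and v': "sum v' S = 1" and e: "0 < e" "e < 1"
      and le: "\<And>f. f \<in> S \<Longrightarrow> (1 - e) * v f \<le> v' f" for v v' e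
  proof -
    define q where "q f = (v' f - (1 - e) * v f) / e" for f
    have q: "0 \<le> q f" if "f \<in> S" for f using le[OF that] e by (simp add: q_def)
    have sq: "sum q S = 1"
      using v v' e by (simp add: q_def sum_subtractf flip: sum_divide_distrib sum_distrib_left)
    have "v' f = (1 - e) * v f + e * q f" for f using e by (simp add: q_def)
    then have "(\<Sum>f\<in>S. v' f *\<^sub>R f) = (1 - e) *\<^sub>R (\<Sum>f\<in>S. v f *\<^sub>R f) + e *\<^sub>R (\<Sum>f\<in>S. q f *\<^sub>R f)"
      by (simp add: scaleR_sum_right scaleR_add_left sum.distrib)
    then have "H (\<Sum>f\<in>S. v' f *\<^sub>R f)
        \<le> (1 - e) * H (\<Sum>f\<in>S. v f *\<^sub>R f) + e * H (\<Sum>f\<in>S. q f *\<^sub>R f)"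
      using cvx hull[OF v] hull[OF q sq] e by (simp add: convex_on_def)
    also have "\<dots> \<le> (1 - e) * H (\<Sum>f\<in>S. v f *\<^sub>R f) + e * m"
      using Hm[OF hull[OF q sq]] e by simp
    finally show ?thesis .
  qed
  define h where "h = H (\<Sum>f\<in>S. w f *\<^sub>R f)"
  (* The sum measures how far u k and w are from dominating each other; the term 1 / Suc k keeps
     e k positive, so that dom applies. *)
  define e where "e k = 1 / Suc k + (\<Sum>f\<in>S. \<bar>1 - u k f / w f\<bar> + \<bar>1 - w f / u k f\<bar>)" for k
  have e0: "e \<longlonglongrightarrow> 0"
  proof -
    have "e \<longlonglongrightarrow> 0 + (\<Sum>f\<in>S. \<bar>1 - w f / w f\<bar> + \<bar>1 - w f / w f\<bar>)"
      unfolding e_def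
      by (intro tendsto_add tendsto_sum tendsto_rabs tendsto_diff tendsto_divide tendsto_const
          u(1) LIMSEQ_inverse_real_of_nat[unfolded inverse_eq_divide])
        (use w in force)+
    also have "0 + (\<Sum>f\<in>S. \<bar>1 - w f / w f\<bar> + \<bar>1 - w f / w f\<bar>) = 0"
      using w by (simp add: order_less_imp_not_eq2)
    finally show ?thesis .
  qed
  have epos: "0 < e k" for k
    unfolding e_def by (intro add_pos_nonneg sum_nonneg) auto
  have ef: "\<bar>1 - u k f / w f\<bar> \<le> e k" "\<bar>1 - w f / u k f\<bar> \<le> e k" if "f \<in> S" for k f
  proof -
    have "\<bar>1 - u k f / w f\<bar> + \<bar>1 - w f / u k f\<bar>
        \<le> (\<Sum>f\<in>S. \<bar>1 - u k f / w f\<bar> + \<bar>1 - w f / u k f\<bar>)"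
      by (rule member_le_sum[OF that _ fin, of "\<lambda>f. \<bar>1 - u k f / w f\<bar> + \<bar>1 - w f / u k f\<bar>"]) auto
    also have "\<dots> \<le> e k" by (simp add: e_def)
    finally show "\<bar>1 - u k f / w f\<bar> \<le> e k" "\<bar>1 - w f / u k f\<bar> \<le> e k" by linarith+
  qed
  have upos: "\<forall>\<^sub>F k in sequentially. \<forall>f\<in>S. 0 < u k f"
    using fin by (intro eventually_ball_finite ballI order_tendstoD(1)[OF u(1)] w(1))
  have e1: "\<forall>\<^sub>F k in sequentially. e k < 1"
    using e0 by (rule order_tendstoD) simp
  have up: "\<forall>\<^sub>F k in sequentially. H (\<Sum>f\<in>S. u k f *\<^sub>R f) \<le> (1 - e k) * h + e k * m"
    using upos e1 u(2)
  proof eventually_elim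
    case (elim k)
    show ?case unfolding h_def
    proof (rule dom)
      fix f assume f: "f \<in> S"
      show "(1 - e k) * w f \<le> u k f" using ef(1)[OF f, of k] w(1)[OF f] by (simp add: field_simps abs_le_iff)
    qed (use elim w epos in \<open>auto intro: less_imp_le\<close>)
  qed
  have lo: "\<forall>\<^sub>F k in sequentially. (h - e k * m) / (1 - e k) \<le> H (\<Sum>f\<in>S. u k f *\<^sub>R f)"
    using upos e1 u(2)
  proof eventually_elim
    case (elim k)
    have "h \<le> (1 - e k) * H (\<Sum>f\<in>S. u k f *\<^sub>R f) + e k * m"
      unfolding h_def
    proof (rule dom)
      fix f assume f: "f \<in> S"
      show "(1 - e k) * u k f \<le> w f" using ef(2)[OF f, of k] elim f by (auto simp: field_simps abs_le_iff)
    qed (use elim w epos in \<open>auto intro: less_imp_le\<close>)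
    then show ?case using elim by (simp add: field_simps)
  qed
  have "(\<lambda>k. (1 - e k) * h + e k * m) \<longlonglongrightarrow> (1 - 0) * h + 0 * m"
    by (intro tendsto_intros e0)
  moreover have "(\<lambda>k. (h - e k * m) / (1 - e k)) \<longlonglongrightarrow> (h - 0 * m) / (1 - 0)"
    by (intro tendsto_intros e0) simp
  ultimately show ?thesis
    using tendsto_sandwich[OF lo up] unfolding h_def by simp
qed

text \<open>
  Without a topology on the vector space, the combination is not a random vector and \<open>H\<close> is not a
  Borel function. Instead the weights are approximated by simple functions, renormalized to sum to one.
  The combination then takes finitely many values, so \<open>H\<close> of it is measurable whatever \<open>H\<close> is, and continuity passes
  this to the limit.
\<close>
lemma borel_measurable_convex_on_combination:
  fixes H :: "'a :: real_vector \<Rightarrow> real"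
  assumes fin: "finite S" and cvx: "convex_on (convex hull S) H"
    and meas: "\<And>f. f \<in> S \<Longrightarrow> (\<lambda>x. w x f) \<in> borel_measurable M"
    and w: "\<And>x f. x \<in> space M \<Longrightarrow> f \<in> S \<Longrightarrow> 0 < w x f" "\<And>x. x \<in> space M \<Longrightarrow> sum (w x) S = 1"
  shows "(\<lambda>x. H (\<Sum>f\<in>S. w x f *\<^sub>R f)) \<in> borel_measurable M"
proof -
  have "\<exists>s. (\<forall>k. simple_function M (s k)) \<and> (\<forall>x\<in>space M. (\<lambda>k. s k x) \<longlonglongrightarrow> w x f)" if "f \<in> S" for f
    using borel_measurable_implies_sequence_metric[OF meas[OF that], of 0] by blast
  then obtain s where s: "\<And>f k. f \<in> S \<Longrightarrow> simple_function M (s f k)"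
      "\<And>f x. f \<in> S \<Longrightarrow> x \<in> space M \<Longrightarrow> (\<lambda>k. s f k x) \<longlonglongrightarrow> w x f"
    by metis
  define t where "t k x = (\<Sum>f\<in>S. s f k x)" for k x
  have t: "(\<lambda>k. t k x) \<longlonglongrightarrow> 1" if "x \<in> space M" for x
    using tendsto_sum[of S "\<lambda>f k. s f k x" "\<lambda>f. w x f" sequentially] s(2)[OF _ that] w(2)[OF that]
    by (simp add: t_def)
  have ts: "simple_function M (t k)" for k
    unfolding t_def using s by (intro simple_function_sum)
  show ?thesis
  proof (rule borel_measurable_LIMSEQ_real[where u = "\<lambda>k x. H (\<Sum>f\<in>S. (s f k x / t k x) *\<^sub>R f)"])
    fix x assume x: "x \<in> space M"
    show "(\<lambda>k. H (\<Sum>f\<in>S. (s f k x / t k x) *\<^sub>R f)) \<longlonglongrightarrow> H (\<Sum>f\<in>S. w x f *\<^sub>R f)"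
    proof (rule convex_on_combination_tendsto[OF fin cvx])
      fix f assume f: "f \<in> S"
      show "(\<lambda>k. s f k x / t k x) \<longlonglongrightarrow> w x f"
        using tendsto_divide[OF s(2)[OF f x] t[OF x]] by simp
      show "0 < w x f" by (rule w(1)[OF x f])
    next
      have "\<forall>\<^sub>F k in sequentially. 0 < t k x" using t[OF x] by (rule order_tendstoD) simp
      then show "\<forall>\<^sub>F k in sequentially. (\<Sum>f\<in>S. s f k x / t k x) = 1"
        by eventually_elim (simp add: t_def flip: sum_divide_distrib)
    qed (rule w(2)[OF x])
  next
    fix k
    have "simple_function M (\<lambda>x. (s f k x / t k x) *\<^sub>R f)" if "f \<in> S" for f
      by (rule simple_function_compose2[OF s(1)[OF that] ts, where h = "\<lambda>a b. (a / b) *\<^sub>R f"])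
    then have "simple_function M (\<lambda>x. \<Sum>f\<in>S. (s f k x / t k x) *\<^sub>R f)"
      by (intro simple_function_sum)
    then have "simple_function M (H \<circ> (\<lambda>x. \<Sum>f\<in>S. (s f k x / t k x) *\<^sub>R f))"
      by (rule simple_function_compose)
    then show "(\<lambda>x. H (\<Sum>f\<in>S. (s f k x / t k x) *\<^sub>R f)) \<in> borel_measurable M"
      by (intro borel_measurable_simple_function) (simp add: comp_def)
  qed
qed

section \<open>Solving the risk inequality\<close>

text \<open>
  The three terms of \<open>bound\<close> are the oracle risk, the price \<open>L / l\<close> of the number of candidates and
  the variance \<open>l * (c * b)\<close>, where \<open>b\<close> stands for \<open>G powr (1 / \<kappa>)\<close> and \<open>G\<close> is the scale at which the
  margin bound is linearized. At \<open>l = \<gamma> / (2 * c * b)\<close> the variance term is \<open>\<gamma> / 2\<close>, and \<open>\<beta> * c \<le> 1 / 576\<close>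
  makes \<open>L / l\<close> a small multiple of \<open>\<gamma>\<close>. The constraint \<open>l * K \<le> 1\<close> may force the smaller \<open>l = 1 / K\<close>;
  the bound on \<open>G * (\<beta> * K)\<close> then still gives \<open>L / l = L * K \<le> 3 / 8 * \<gamma>\<close>.
\<close>
lemma excess_le_four_rate:
  fixes B G \<gamma> b c K \<beta> L e :: real
  assumes pos: "L > 0" "G > 0" "\<gamma> > 0" "b > 0" "c > 0" "K > 0" "\<beta> > 0"
    and \<gamma>: "\<gamma>\<^sup>2 = b * L / \<beta>" "\<gamma> \<le> G"
    and B: "B \<le> G"
    and \<beta>: "\<beta> * c \<le> 1 / 576" "G * (\<beta> * K) \<le> 3 / 8 * b"
    and bound: "\<And>l. 0 < l \<Longrightarrow> l * K \<le> 1 \<Longrightarrow> l * (c * b) \<le> G / 2 \<Longrightarrow>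
      e * (1 - l * (c * b) / G) \<le> B + 2 * L / l + l * (c * b)"
  shows "e \<le> B + 4 * \<gamma>"
proof -
  define l where "l = min (\<gamma> / (2 * c * b)) (1 / K)"
  have l: "0 < l" using pos by (simp add: l_def)
  have lK: "l * K \<le> 1"
  proof -
    have "l \<le> 1 / K" by (simp add: l_def)
    then show ?thesis using pos by (simp add: field_simps)
  qed
  have lV: "l * (c * b) \<le> \<gamma> / 2"
  proof -
    have "l \<le> \<gamma> / (2 * c * b)" by (simp add: l_def)
    then show ?thesis using pos by (simp add: field_simps)
  qed
  have L: "L = \<beta> * \<gamma>\<^sup>2 / b" using \<gamma>(1) pos by (simp add: field_simps)
  have Ll: "L / l \<le> 3 / 8 * \<gamma>"
  proof (cases "\<gamma> / (2 * c * b) \<le> 1 / K")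
    case True
    then have "L / l = 2 * (\<beta> * c) * \<gamma>"
      using pos by (simp add: l_def L power2_eq_square)
    also have "\<dots> \<le> 2 * (1 / 576) * \<gamma>"
      using \<beta>(1) pos by (intro mult_right_mono mult_left_mono) auto
    also have "\<dots> \<le> 3 / 8 * \<gamma>" using pos by simp
    finally show ?thesis .
  next
    case False
    then have "L / l = (\<beta> * K) * \<gamma> / b * \<gamma>"
      using pos by (simp add: l_def L power2_eq_square)
    also have "\<dots> \<le> (\<beta> * K) * G / b * \<gamma>"
      using pos \<gamma>(2) by (intro mult_right_mono divide_right_mono mult_left_mono) auto
    also have "\<dots> \<le> 3 / 8 * \<gamma>"
      using pos \<beta>(2) by (intro mult_right_mono) (auto simp: field_simps)
    finally show ?thesis .
  qed
  (* Since B <= G, the part t * B of the relative loss costs no more than the variance term; the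
     factor 1 - t >= 1/2 turns 7/4 into at most 7/2. *)
  define t where "t = l * (c * b) / G"
  have t: "t \<le> 1 / 2" using lV \<gamma>(2) pos by (simp add: t_def field_simps)
  have t0: "0 \<le> t" using l pos by (simp add: t_def)
  have "t * B \<le> t * G" using B t0 by (intro mult_left_mono)
  also have "\<dots> = l * (c * b)" using pos by (simp add: t_def)
  finally have tB: "t * B \<le> \<gamma> / 2" using lV by simp
  have "e * (1 - t) \<le> B + 2 * L / l + l * (c * b)"
    unfolding t_def using lV \<gamma>(2) by (intro bound l lK) auto
  moreover have "(e - B) * (1 - t) = e * (1 - t) - B + t * B" by (simp add: algebra_simps)
  ultimately have "(e - B) * (1 - t) \<le> 7 / 4 * \<gamma>"
    using Ll lV tB times_divide_eq_right[of 2 L l] by linarith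
  moreover have "(e - B) * (1 / 2) \<le> (e - B) * (1 - t)" if "e \<ge> B"
    using that t by (intro mult_left_mono) auto
  ultimately show ?thesis using pos by (cases "e \<ge> B") auto
qed

lemma beta1_bounds:
  assumes "c > 0" "K \<ge> 1"
  shows "beta1 c K > 0" "beta1 c K * c \<le> 1 / 576" "beta1 c K * K \<le> 3 / 8"
    "c * (beta1 c K * K) \<le> 3 / 8"
proof -
  show "beta1 c K > 0" using assms by (simp add: beta1_def add_pos_pos)
  have "beta1 c K \<le> 1 / (576 * c)" by (simp add: beta1_def)
  then show "beta1 c K * c \<le> 1 / 576" using assms by (simp add: field_simps)
  have "beta1 c K \<le> 1 / (8 * (4 * c + K / 3))" by (simp add: beta1_def)
  also have "\<dots> \<le> 1 / (8 * (K / 3))" using assms by (intro divide_left_mono mult_pos_pos) auto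
  finally show "beta1 c K * K \<le> 3 / 8" using assms by (simp add: field_simps)
  have "beta1 c K \<le> ln 2 / (96 * c * K)" by (simp add: beta1_def)
  also have "\<dots> \<le> 1 / (96 * c * K)" using assms ln_2_less_1 by (intro divide_right_mono) auto
  finally have "c * (beta1 c K * K) \<le> 1 / 96" using assms by (simp add: field_simps)
  then show "c * (beta1 c K * K) \<le> 3 / 8" by simp
qed

lemma beta2_bounds:
  assumes "c > 0" "K \<ge> 1"
  shows "beta2 c K > 0" "beta2 c K \<le> beta1 c K"
proof -
  show "beta2 c K > 0" using assms beta1_bounds(1)[OF assms] by (simp add: beta2_def add_pos_pos)
  have "beta2 c K \<le> beta1 c K / 2" by (simp add: beta2_def)
  then show "beta2 c K \<le> beta1 c K" using beta1_bounds(1)[OF assms] by simp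
qed

text \<open>
  Linearizing the margin bound in \<open>r\<close> makes it commute with weighted averages and expectations, so
  that the unknown risk reappears on the right-hand side with a small factor.
\<close>
lemma powr_inverse_le_linear:
  fixes G r \<kappa> :: real
  assumes "G > 0" "r \<ge> 0" "\<kappa> \<ge> 1"
  shows "r powr (1 / \<kappa>) \<le> G powr (1 / \<kappa>) * (1 + r / G)"
proof (cases "r \<le> G")
  case True
  have "r powr (1 / \<kappa>) \<le> G powr (1 / \<kappa>) * 1"
    using assms True by (simp add: powr_mono2)
  also have "\<dots> \<le> G powr (1 / \<kappa>) * (1 + r / G)"
    using assms by (intro mult_left_mono) auto
  finally show ?thesis .
next
  case False
  have "r powr (1 / \<kappa>) = G powr (1 / \<kappa>) * (r / G) powr (1 / \<kappa>)"
    using assms by (simp flip: powr_mult)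
  also have "\<dots> \<le> G powr (1 / \<kappa>) * (r / G) powr 1"
    using assms False by (intro mult_left_mono powr_mono) auto
  also have "\<dots> \<le> G powr (1 / \<kappa>) * (1 + r / G)"
    using assms by (intro mult_left_mono) auto
  finally show ?thesis .
qed

text \<open>
  \<open>G powr (1 - 1 / \<kappa>)\<close> is at most \<open>1\<close> or at most \<open>c\<close>. It is therefore absorbed by a factor \<open>s\<close> for which
  both \<open>s\<close> and \<open>c * s\<close> are small, which is how the products \<open>\<beta> * K\<close> and \<open>c * (\<beta> * K)\<close> come in.
\<close>
lemma scale_times_small_le_powr:
  fixes G \<kappa> c s t :: real
  assumes "G > 0" "\<kappa> \<ge> 1" "s \<ge> 0" "s \<le> t" "c * s \<le> t"
    and "G \<le> 1 \<or> G powr (2 - 1 / \<kappa>) \<le> c"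
  shows "G * s \<le> t * G powr (1 / \<kappa>)"
proof (cases "G \<le> 1")
  case True
  then have "G powr 1 \<le> G powr (1 / \<kappa>)"
    using assms by (intro powr_mono') auto
  then have "G * s \<le> G powr (1 / \<kappa>) * t" using assms by (intro mult_mono) auto
  then show ?thesis by (simp add: mult.commute)
next
  case False
  have "G = G powr (1 - 1 / \<kappa>) * G powr (1 / \<kappa>)"
    using assms by (simp flip: powr_add)
  also have "\<dots> \<le> G powr (2 - 1 / \<kappa>) * G powr (1 / \<kappa>)"
    using False by (intro mult_right_mono powr_mono) auto
  also have "\<dots> \<le> c * G powr (1 / \<kappa>)" using assms False by (intro mult_right_mono) auto
  finally have "G * s \<le> (c * G powr (1 / \<kappa>)) * s" using assms by (intro mult_right_mono) auto
  also have "\<dots> = (c * s) * G powr (1 / \<kappa>)" by simp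
  also have "\<dots> \<le> t * G powr (1 / \<kappa>)" using assms by (intro mult_right_mono) auto
  finally show ?thesis .
qed

text \<open>
  Each branch of the residual is the rate of \<open>excess_le_four_rate\<close> at its own scale: \<open>G = B\<close> when the oracle risk
  dominates, and \<open>G = \<gamma>\<close>, the solution of \<open>G\<^sup>2 = G powr (1 / \<kappa>) * L / \<beta>\<close>, when the approximation error is
  below the rate. In the second branch \<open>\<gamma>\<close> may be so large that \<open>\<gamma> powr (2 - 1 / \<kappa>) > c\<close>; the margin
  assumption keeps every candidate's risk below such a \<open>\<gamma>\<close>, and \<open>crude\<close> already gives the claim.
\<close>
lemma excess_le_residual:
  assumes c: "c > 0" and K: "K \<ge> 1" and k: "\<kappa> \<ge> 1" and n: "n \<ge> 1" and M: "M \<ge> 2"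
    and B_def: "B = min_excess_risk \<pi> Q fstar F0" and B0: "0 \<le> B" and Bc: "B powr (2 - 1 / \<kappa>) \<le> c"
    and crude: "\<And>G. 0 < G \<Longrightarrow> c < G powr (2 - 1 / \<kappa>) \<Longrightarrow> e \<le> G"
    and bound: "\<And>G l. 0 < G \<Longrightarrow> B \<le> G \<Longrightarrow> 0 < l \<Longrightarrow> l * K \<le> 1 \<Longrightarrow>
      l * (c * G powr (1 / \<kappa>)) \<le> G / 2 \<Longrightarrow>
      e * (1 - l * (c * G powr (1 / \<kappa>)) / G) \<le> B + 2 * (ln (real M) / real n) / l + l * (c * G powr (1 / \<kappa>))"
  shows "e \<le> B + 4 * residual c K n M \<kappa> F0 \<pi> Q fstar"
proof -
  define L where "L = ln (real M) / real n"
  have L: "L > 0" using M n by (simp add: L_def)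
  note b1 = beta1_bounds[OF c K] and b2 = beta2_bounds[OF c K]
  define p where "p = \<kappa> / (2 * \<kappa> - 1)"
  have p: "p > 0" using k by (simp add: p_def)
  have p2: "p * (2 - 1 / \<kappa>) = 1" using k by (simp add: p_def field_simps)
  have q0: "2 - 1 / \<kappa> > 0" using k by (simp add: field_simps)
  have split: "G powr (2 - 1 / \<kappa>) * G powr (1 / \<kappa>) = G\<^sup>2" if "G > 0" for G
    using that by (simp flip: powr_add add: powr_numeral)
  have Lb: "ln (real M) / (\<beta> * real n) = L / \<beta>" for \<beta> by (simp add: L_def)
  show ?thesis
  proof (cases "B \<ge> (L / beta1 c K) powr p")
    case True
    define g where "g = (B powr (1 / \<kappa>) * L / beta1 c K) powr (1 / 2)"
    have res: "residual c K n M \<kappa> F0 \<pi> Q fstar = g"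
      using True by (simp add: residual_def Let_def Lb g_def L_def p_def mult_ac flip: B_def)
    have Bpos: "B > 0"
    proof -
      have "(L / beta1 c K) powr p > 0" using L b1 by simp
      then show ?thesis using True by linarith
    qed
    have g2: "g\<^sup>2 = B powr (1 / \<kappa>) * L / beta1 c K"
      using Bpos L b1 by (simp add: g_def powr_half_sqrt)
    have "L / beta1 c K = ((L / beta1 c K) powr p) powr (2 - 1 / \<kappa>)"
      using L b1 by (simp add: powr_powr p2)
    also have "\<dots> \<le> B powr (2 - 1 / \<kappa>)" using True q0 by (intro powr_mono2) auto
    finally have "B powr (1 / \<kappa>) * (L / beta1 c K) \<le> B powr (1 / \<kappa>) * B powr (2 - 1 / \<kappa>)"
      by (intro mult_left_mono) auto
    then have "g\<^sup>2 \<le> B\<^sup>2" using split[OF Bpos] g2 by (simp add: mult.commute)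
    then have gB: "g \<le> B" using B0 by (rule power2_le_imp_le)
    have "B * (beta1 c K * K) \<le> 3 / 8 * B powr (1 / \<kappa>)"
      using b1 Bpos k K Bc by (intro scale_times_small_le_powr[where c = c]) auto
    then show ?thesis unfolding res
      using L Bpos c K b1 gB g2
      by (intro excess_le_four_rate[of L B g "B powr (1 / \<kappa>)" c K "beta1 c K"] bound[folded L_def])
        (auto simp: g_def)
  next
    case False
    define g where "g = (L / beta2 c K) powr p"
    have res: "residual c K n M \<kappa> F0 \<pi> Q fstar = g"
      using False by (simp add: residual_def Let_def Lb g_def L_def p_def flip: B_def)
    have gpos: "g > 0" using L b2 by (simp add: g_def)
    have "(L / beta1 c K) powr p \<le> g"
      unfolding g_def using L b1 b2 p by (intro powr_mono2 divide_left_mono) auto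
    then have Bg: "B \<le> g" using False by linarith
    show ?thesis
    proof (cases "c < g powr (2 - 1 / \<kappa>)")
      case True
      then have "e \<le> g" using gpos by (intro crude)
      then show ?thesis unfolding res using B0 gpos by linarith
    next
      case False
      have "L / beta2 c K = g powr (2 - 1 / \<kappa>)"
        using L b2 by (simp add: g_def powr_powr p2)
      then have g2: "g\<^sup>2 = g powr (1 / \<kappa>) * L / beta2 c K"
        using split[OF gpos] by (metis mult.commute times_divide_eq_right)
      have "beta2 c K * c \<le> beta1 c K * c" "beta2 c K * K \<le> beta1 c K * K"
        "c * (beta2 c K * K) \<le> c * (beta1 c K * K)"
        using b2 c K by (auto intro!: mult_right_mono mult_left_mono)
      then have s: "beta2 c K * c \<le> 1 / 576" "beta2 c K * K \<le> 3 / 8" "c * (beta2 c K * K) \<le> 3 / 8"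
        using b1 by linarith+
      have "g * (beta2 c K * K) \<le> 3 / 8 * g powr (1 / \<kappa>)"
        using b2 gpos k K False s by (intro scale_times_small_le_powr[where c = c]) auto
      then show ?thesis unfolding res
        using L gpos c K b2 Bg g2 s B0
        by (intro excess_le_four_rate[of L g g "g powr (1 / \<kappa>)" c K "beta2 c K"] bound[folded L_def])
          auto
    qed
  qed
qed

section \<open>Risk of data-dependent weights\<close>

locale margin_aggregation = P: prob_space P + pi: prob_space \<pi>
  for P :: "'w measure" and \<pi> :: "'z measure" +
  fixes X :: "nat \<Rightarrow> 'w \<Rightarrow> 'z" and F F0 :: "'f :: real_vector set" and Q :: "'z \<Rightarrow> 'f \<Rightarrow> real"
    and fstar :: 'f and \<kappa> c K :: real and n :: nat
  assumes n: "n \<ge> 1"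
    and indep: "P.indep_vars (\<lambda>_. \<pi>) X {1..n}"
    and dist: "\<And>i. i \<in> {1..n} \<Longrightarrow> distr P \<pi> (X i) = \<pi>"
    and F_subspace: "subspace F"
    and F_risk: "\<And>f. f \<in> F \<Longrightarrow> has_risk \<pi> Q f"
    and fstar: "risk_minimizer \<pi> Q F fstar"
    and F0_F: "F0 \<subseteq> F" and F0_fin: "finite F0" and F0_card: "card F0 \<ge> 2"
    and \<kappa>: "\<kappa> \<ge> 1" and c: "c > 0" and margin: "margin_assumption \<pi> Q fstar \<kappa> c F0"
    and K: "K \<ge> 1" and bounded: "\<And>f. f \<in> F0 \<Longrightarrow> AE z in \<pi>. \<bar>Q z f - Q z fstar\<bar> \<le> K"
begin

abbreviation R :: "'f \<Rightarrow> real" where "R \<equiv> excess_risk \<pi> Q fstar"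

abbreviation A\<^sub>n :: "'w \<Rightarrow> 'f \<Rightarrow> real" where "A\<^sub>n \<omega> \<equiv> empirical_risk Q n (\<lambda>i. X i \<omega>)"

definition Y :: "'f \<Rightarrow> 'z \<Rightarrow> real" where "Y f z = Q z f - Q z fstar"

lemma F0_ne: "F0 \<noteq> {}"
  using F0_card by auto

lemma X_measurable: "i \<in> {1..n} \<Longrightarrow> X i \<in> measurable P \<pi>"
  using indep by (auto simp: P.indep_vars_def)

lemma loss_measurable: "f \<in> F \<Longrightarrow> (\<lambda>z. Q z f) \<in> borel_measurable \<pi>"
  using F_risk by (auto simp: has_risk_def)

lemma fstar_F: "fstar \<in> F" and fstar_integrable: "integrable \<pi> (\<lambda>z. Q z fstar)"
  using fstar by (auto simp: risk_minimizer_def is_arg_min_def)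

lemma Y_measurable: "f \<in> F0 \<Longrightarrow> Y f \<in> borel_measurable \<pi>"
  unfolding Y_def using F0_F fstar_F loss_measurable by (intro borel_measurable_diff) auto

lemma Y_bounded: "f \<in> F0 \<Longrightarrow> AE z in \<pi>. \<bar>Y f z\<bar> \<le> K"
  using bounded by (simp add: Y_def)

lemma Y_integrable: "f \<in> F0 \<Longrightarrow> integrable \<pi> (Y f)"
  by (rule pi.integrable_const_bound[where B = K]) (use Y_bounded Y_measurable in auto)

lemma loss_integrable: "f \<in> F0 \<Longrightarrow> integrable \<pi> (\<lambda>z. Q z f)"
  using Bochner_Integration.integrable_add[OF Y_integrable fstar_integrable] by (simp add: Y_def)

lemma R_eq: "f \<in> F0 \<Longrightarrow> R f = (\<integral>z. Y f z \<partial>\<pi>)"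
  using loss_integrable fstar_integrable by (simp add: Y_def excess_risk_def risk_def)

lemma R_nonneg: "f \<in> F \<Longrightarrow> integrable \<pi> (\<lambda>z. Q z f) \<Longrightarrow> 0 \<le> R f"
  using fstar by (force simp: risk_minimizer_def is_arg_min_def excess_risk_def)

lemma Y_second_moment:
  assumes "f \<in> F0"
  shows "integrable \<pi> (\<lambda>z. (Y f z)\<^sup>2)" "(\<integral>z. (Y f z)\<^sup>2 \<partial>\<pi>) \<le> c * R f powr (1 / \<kappa>)"
  using margin assms by (auto simp: margin_assumption_def Y_def)

text \<open>
  The margin assumption bounds the second moment of the loss difference, which is at least the
  square of its mean \<open>R f\<close>; so it also bounds the risks themselves.
\<close>
lemma R_powr_le: 
  assumes f: "f \<in> F0"
  shows "R f powr (2 - 1 / \<kappa>) \<le> c"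
proof (cases "R f = 0")
  case True
  with c show ?thesis by simp
next
  case False
  then have pos: "R f > 0" using R_nonneg[of f] F0_F f loss_integrable[OF f] by fastforce
  have "(R f)\<^sup>2 \<le> (\<integral>z. (Y f z)\<^sup>2 \<partial>\<pi>)"
    using pi.variance_positive[of "Y f"] pi.variance_eq[OF Y_integrable[OF f] Y_second_moment(1)[OF f]]
    by (simp add: R_eq[OF f])
  also note Y_second_moment(2)[OF f]
  also have "(R f)\<^sup>2 = R f powr (2 - 1 / \<kappa>) * R f powr (1 / \<kappa>)"
    using pos by (simp flip: powr_add add: powr_numeral)
  finally show ?thesis using pos by simp
qed

lemma empirical_diff: "A\<^sub>n \<omega> f - A\<^sub>n \<omega> fstar = (\<Sum>i=1..n. Y f (X i \<omega>)) / n"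
  by (simp add: empirical_risk_def Y_def sum_subtractf diff_divide_distrib)

lemma empirical_diff_integrable:
  assumes f: "f \<in> F0"
  shows "integrable P (\<lambda>\<omega>. A\<^sub>n \<omega> f - A\<^sub>n \<omega> fstar)"
    and "P.expectation (\<lambda>\<omega>. A\<^sub>n \<omega> f - A\<^sub>n \<omega> fstar) = R f"
proof -
  have i: "integrable P (\<lambda>\<omega>. Y f (X i \<omega>))" if "i \<in> {1..n}" for i
    using integrable_distr[OF X_measurable[OF that], of "Y f"] Y_integrable[OF f] dist[OF that] by simp
  have e: "P.expectation (\<lambda>\<omega>. Y f (X i \<omega>)) = R f" if "i \<in> {1..n}" for i
    using integral_distr[OF X_measurable[OF that] Y_measurable[OF f]] dist[OF that]
    by (simp add: R_eq[OF f])
  show "integrable P (\<lambda>\<omega>. A\<^sub>n \<omega> f - A\<^sub>n \<omega> fstar)"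
    unfolding empirical_diff using i by (intro integrable_divide_zero Bochner_Integration.integrable_sum) auto
  show "P.expectation (\<lambda>\<omega>. A\<^sub>n \<omega> f - A\<^sub>n \<omega> fstar) = R f"
    unfolding empirical_diff using i e n by simp
qed

text \<open>
  The scaled shortfall of the empirical excess risk of \<open>f\<close>, penalized by the linearized variance so
  that its exponential has mean at most one for each \<open>f\<close> in \<open>F0\<close> when \<open>l * K \<le> 1\<close>.
\<close>
definition deviation :: "real \<Rightarrow> real \<Rightarrow> 'w \<Rightarrow> 'f \<Rightarrow> real" where
  "deviation l G \<omega> f = real n * l * (R f - (A\<^sub>n \<omega> f - A\<^sub>n \<omega> fstar))
     - real n * l\<^sup>2 * (c * G powr (1 / \<kappa>)) * (1 + R f / G)"

lemma exp_deviation: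
  assumes f: "f \<in> F0" and G: "G > 0" and l: "l > 0" "l * K \<le> 1"
  shows "integrable P (\<lambda>\<omega>. exp (deviation l G \<omega> f))"
    and "P.expectation (\<lambda>\<omega>. exp (deviation l G \<omega> f)) \<le> 1"
proof -
  define W where "W = (c * G powr (1 / \<kappa>)) * (1 + R f / G)"
  define C where "C = n * l * R f - n * l\<^sup>2 * W"
  have W: "(\<integral>z. (Y f z)\<^sup>2 \<partial>\<pi>) \<le> W"
  proof -
    have "R f \<ge> 0" using R_nonneg F0_F f loss_integrable by auto
    then have "c * R f powr (1 / \<kappa>) \<le> W"
      using powr_inverse_le_linear[OF G _ \<kappa>, of "R f"] c by (simp add: W_def mult.assoc)
    then show ?thesis using Y_second_moment(2)[OF f] by linarith
  qed
  have eq: "exp (deviation l G \<omega> f) = exp (- l * (\<Sum>i\<in>{1..n}. Y f (X i \<omega>))) * exp C" for \<omega>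
    unfolding exp_add[symmetric] deviation_def empirical_diff C_def W_def
    using n by (simp add: field_simps)
  note mom = P.exp_moment_iid_sum[OF _ indep dist pi.prob_space_axioms Y_measurable[OF f]
      Y_bounded[OF f] less_imp_le[OF l(1)] l(2), simplified finite_atLeastAtMost]
  show "integrable P (\<lambda>\<omega>. exp (deviation l G \<omega> f))"
    unfolding eq using mom(1) by simp
  have "P.expectation (\<lambda>\<omega>. exp (deviation l G \<omega> f))
      = P.expectation (\<lambda>\<omega>. exp (- l * (\<Sum>i\<in>{1..n}. Y f (X i \<omega>)))) * exp C"
    unfolding eq by simp
  also have "\<dots> \<le> exp (card {1..n} * (- l * R f + l\<^sup>2 * (\<integral>z. (Y f z)\<^sup>2 \<partial>\<pi>))) * exp C"
    unfolding R_eq[OF f] using mom(2) by (intro mult_right_mono) auto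
  also have "\<dots> = exp (n * l\<^sup>2 * ((\<integral>z. (Y f z)\<^sup>2 \<partial>\<pi>) - W))"
    unfolding exp_add[symmetric] C_def by (simp add: algebra_simps)
  also have "\<dots> \<le> 1"
    using W by (simp add: mult_nonneg_nonpos)
  finally show "P.expectation (\<lambda>\<omega>. exp (deviation l G \<omega> f)) \<le> 1" .
qed

text \<open>
  The common core of both procedures. Each selects weights under which the average
  empirical risk exceeds every candidate's by at most \<open>ln (card F0) / n\<close>. Comparing with the
  oracle \<open>g\<close>, whose empirical excess risk has mean exactly \<open>R g\<close>, leaves only the shortfalls
  \<open>R f - (A\<^sub>n \<omega> f - A\<^sub>n \<omega> fstar)\<close>, and \<open>weighted_sum_le_ln_sum_exp\<close> controls their average uniformly
  in the weights.

  The weights are chosen separately for each \<open>\<omega>\<close>, because the sets on which an empirical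
  minimizer equals a given \<open>f\<close> need not be events: ties can be broken in a non-measurable way.
  In the expectation only \<open>a\<close>, the oracle and the sum of exponentials appear.
\<close>
lemma randomized_selection_bound:
  assumes int: "integrable P a"
    and weights: "\<And>\<omega>. \<omega> \<in> space P \<Longrightarrow> \<exists>w. (\<forall>f\<in>F0. 0 \<le> w f) \<and> sum w F0 = 1 \<and>
      a \<omega> \<le> (\<Sum>f\<in>F0. w f * R f) \<and>
      (\<forall>g\<in>F0. (\<Sum>f\<in>F0. w f * A\<^sub>n \<omega> f) \<le> A\<^sub>n \<omega> g + ln (card F0) / n)"
  shows "P.expectation a \<le> min_excess_risk \<pi> Q fstar F0
    + 4 * residual c K n (card F0) \<kappa> F0 \<pi> Q fstar"
proof -
  define M where "M = card F0"
  have M: "real M > 0" using F0_card by (simp add: M_def)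
  have nn: "real n > 0" using n by simp
  define B where "B = min_excess_risk \<pi> Q fstar F0"
  have "B \<in> R ` F0" unfolding B_def min_excess_risk_def using F0_fin F0_ne by (intro Min_in) auto
  then obtain g where g: "g \<in> F0" "R g = B" by auto
  define e where "e = P.expectation a"
  have "e \<le> B + 4 * residual c K n M \<kappa> F0 \<pi> Q fstar"
  proof (rule excess_le_residual[OF c K \<kappa> n _ B_def])
    show "2 \<le> M" using F0_card by (simp add: M_def)
    show "0 \<le> B" using R_nonneg[of g] F0_F g loss_integrable by auto
    show "B powr (2 - 1 / \<kappa>) \<le> c" using R_powr_le[OF g(1)] g by simp
  next
    fix G :: real assume G: "0 < G" "c < G powr (2 - 1 / \<kappa>)"
    have RG: "R f \<le> G" if "f \<in> F0" for f
    proof (rule ccontr)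
      assume "\<not> R f \<le> G"
      then have "G powr (2 - 1 / \<kappa>) \<le> R f powr (2 - 1 / \<kappa>)"
        using G \<kappa> by (intro powr_mono2) (auto simp: field_simps)
      then show False using R_powr_le[OF that] G by linarith
    qed
    have "a \<omega> \<le> G" if om: "\<omega> \<in> space P" for \<omega>
    proof -
      obtain w where w: "\<And>f. f \<in> F0 \<Longrightarrow> 0 \<le> w f" "sum w F0 = 1" "a \<omega> \<le> (\<Sum>f\<in>F0. w f * R f)"
        using weights[OF om] by blast
      note w(3)
      also have "(\<Sum>f\<in>F0. w f * R f) \<le> (\<Sum>f\<in>F0. w f * G)"
        using w RG by (intro sum_mono mult_left_mono) auto
      also have "\<dots> = G" using w by (simp flip: sum_distrib_right)
      finally show ?thesis .
    qed
    then have "e \<le> P.expectation (\<lambda>_. G)" unfolding e_def by (intro integral_mono int) auto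
    then show "e \<le> G" by (simp add: P.prob_space)
  next
    fix G l :: real
    assume G: "0 < G" and l: "0 < l" "l * K \<le> 1" and lG: "l * (c * G powr (1 / \<kappa>)) \<le> G / 2"
    define V where "V = c * G powr (1 / \<kappa>)"
    define L where "L = ln (real M) / real n"
    define S where "S \<omega> = (\<Sum>f\<in>F0. exp (deviation l G \<omega> f))" for \<omega>
    define D where "D \<omega> = A\<^sub>n \<omega> g - A\<^sub>n \<omega> fstar" for \<omega>
    define t where "t = l * V / G"
    have t: "t \<le> 1 / 2" using lG G by (simp add: t_def V_def field_simps)
    have Sint: "integrable P S"
      unfolding S_def using exp_deviation(1) G l by (intro Bochner_Integration.integrable_sum) auto
    have ES: "P.expectation S \<le> M"
    proof -
      have "P.expectation S = (\<Sum>f\<in>F0. P.expectation (\<lambda>\<omega>. exp (deviation l G \<omega> f)))"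
        unfolding S_def using exp_deviation(1) G l by (intro Bochner_Integration.integral_sum) auto
      also have "\<dots> \<le> (\<Sum>f\<in>F0. 1)" using exp_deviation(2) G l by (intro sum_mono) auto
      finally show ?thesis by (simp add: M_def)
    qed
    have Dint: "integrable P D" "P.expectation D = B"
      unfolding D_def using empirical_diff_integrable[OF g(1)] g by auto
    (* Divided by n * l, the log-sum-exp bound on the weighted deviations, with t collecting the
       part of the variance penalty that is proportional to the risk. *)
    have pw: "a \<omega> * (1 - t) \<le> D \<omega> + L + l * V + (ln M + S \<omega> / M - 1) / (n * l)"
      if om: "\<omega> \<in> space P" for \<omega>
    proof -
      obtain w where w: "\<And>f. f \<in> F0 \<Longrightarrow> 0 \<le> w f" "sum w F0 = 1" "a \<omega> \<le> (\<Sum>f\<in>F0. w f * R f)"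
          "(\<Sum>f\<in>F0. w f * A\<^sub>n \<omega> f) \<le> A\<^sub>n \<omega> g + ln (card F0) / n"
        using weights[OF om] g by blast
      define r where "r = (\<Sum>f\<in>F0. w f * R f)"
      define u where "u = (\<Sum>f\<in>F0. w f * A\<^sub>n \<omega> f)"
      have Spos: "S \<omega> > 0" unfolding S_def using F0_fin F0_ne by (intro sum_pos) auto
      have "w f * deviation l G \<omega> f = n * l * (w f * R f - w f * A\<^sub>n \<omega> f + w f * A\<^sub>n \<omega> fstar
          - l * V * w f - t * (w f * R f))" for f
        by (simp add: deviation_def V_def t_def algebra_simps power2_eq_square add_divide_distrib)
      then have "(\<Sum>f\<in>F0. w f * deviation l G \<omega> f)
          = n * l * (r - u + A\<^sub>n \<omega> fstar - l * V - t * r)"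
        using w(2) by (simp add: r_def u_def sum.distrib sum_subtractf
            flip: sum_distrib_left sum_distrib_right)
      moreover have "(\<Sum>f\<in>F0. w f * deviation l G \<omega> f) \<le> ln (S \<omega>)"
        unfolding S_def by (rule weighted_sum_le_ln_sum_exp[OF F0_fin w(1,2)])
      moreover have "ln (S \<omega>) \<le> ln M + S \<omega> / M - 1" by (rule ln_le_linear[OF Spos M])
      ultimately have "n * l * (r - u + A\<^sub>n \<omega> fstar - l * V - t * r) \<le> ln M + S \<omega> / M - 1"
        by linarith
      then have "r - u + A\<^sub>n \<omega> fstar - l * V - t * r \<le> (ln M + S \<omega> / M - 1) / (n * l)"
        using l nn by (simp add: pos_le_divide_eq mult.commute)
      moreover have "u \<le> A\<^sub>n \<omega> g + L" using w(4) by (simp add: u_def L_def M_def)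
      moreover have "a \<omega> * (1 - t) \<le> r * (1 - t)" using w(3) t by (intro mult_right_mono) (auto simp: r_def)
      ultimately show ?thesis by (simp add: D_def algebra_simps)
    qed
    have "e * (1 - t) = P.expectation (\<lambda>\<omega>. a \<omega> * (1 - t))" by (simp add: e_def)
    also have "\<dots> \<le> P.expectation (\<lambda>\<omega>. D \<omega> + L + l * V + (ln M + S \<omega> / M - 1) / (n * l))"
      using pw int Sint Dint by (intro integral_mono) auto
    also have "\<dots> = B + L + l * V + (ln M + P.expectation S / M - 1) / (n * l)"
      using Sint Dint by (simp add: P.prob_space)
    also have "\<dots> \<le> B + L + l * V + (ln M + M / M - 1) / (n * l)"
      using ES l nn M by (intro add_left_mono divide_right_mono diff_right_mono add_left_mono) auto
    also have "\<dots> = B + L + l * V + L / l" using M by (simp add: L_def)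
    also have "\<dots> \<le> B + 2 * L / l + l * V"
    proof -
      have "l * 1 \<le> l * K" using K l by (intro mult_left_mono) auto
      then have "l \<le> 1" using l by linarith
      moreover have "L \<ge> 0" using M n by (simp add: L_def)
      ultimately have "l * L \<le> 1 * L" by (intro mult_right_mono)
      then have "L \<le> L / l" using l by (simp add: field_simps)
      then show ?thesis by simp
    qed
    finally show "e * (1 - l * (c * G powr (1 / \<kappa>)) / G)
        \<le> B + 2 * (ln (real M) / real n) / l + l * (c * G powr (1 / \<kappa>))"
      by (simp add: t_def V_def L_def)
  qed
  then show ?thesis by (simp add: e_def B_def M_def)
qed

section \<open>Empirical risk minimization and exponential weights\<close>

lemma erm_bound:
  assumes erm: "\<And>\<omega>. \<omega> \<in> space P \<Longrightarrow> is_erm Q n F0 (\<lambda>i. X i \<omega>) (erm \<omega>)"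
    and meas: "(\<lambda>\<omega>. risk \<pi> Q (erm \<omega>)) \<in> borel_measurable P"
  shows "integrable P (\<lambda>\<omega>. R (erm \<omega>))"
    and "P.expectation (\<lambda>\<omega>. R (erm \<omega>)) \<le> min_excess_risk \<pi> Q fstar F0
    + 4 * residual c K n (card F0) \<kappa> F0 \<pi> Q fstar"
proof -
  have in0: "erm \<omega> \<in> F0" and le: "g \<in> F0 \<Longrightarrow> A\<^sub>n \<omega> (erm \<omega>) \<le> A\<^sub>n \<omega> g" if "\<omega> \<in> space P" for \<omega> g
    using erm[OF that] by (force simp: is_erm_def is_arg_min_def)+
  show int: "integrable P (\<lambda>\<omega>. R (erm \<omega>))"
  proof (rule P.integrable_const_bound[where B = "Max ((\<lambda>f. \<bar>R f\<bar>) ` F0)"])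
    show "AE \<omega> in P. norm (R (erm \<omega>)) \<le> Max ((\<lambda>f. \<bar>R f\<bar>) ` F0)"
      using in0 F0_fin by (intro AE_I2) auto
    show "(\<lambda>\<omega>. R (erm \<omega>)) \<in> borel_measurable P"
      unfolding excess_risk_def using meas by measurable
  qed
  show "P.expectation (\<lambda>\<omega>. R (erm \<omega>)) \<le> min_excess_risk \<pi> Q fstar F0
    + 4 * residual c K n (card F0) \<kappa> F0 \<pi> Q fstar"
  proof (rule randomized_selection_bound[OF int])
    fix \<omega> assume om: "\<omega> \<in> space P"
    have pick: "(\<Sum>f\<in>F0. (if f = erm \<omega> then 1 else 0) * v f) = v (erm \<omega>)" for v :: "'f \<Rightarrow> real"
      using in0[OF om] F0_fin by (simp add: if_distrib[of "\<lambda>x. x * _"] cong: if_cong)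
    have "ln (card F0) / n \<ge> 0" using F0_card by simp
    then have "A\<^sub>n \<omega> (erm \<omega>) \<le> A\<^sub>n \<omega> g + ln (card F0) / n" if "g \<in> F0" for g
      using le[OF om that] by linarith
    then show "\<exists>w. (\<forall>f\<in>F0. 0 \<le> w f) \<and> sum w F0 = 1 \<and>
      R (erm \<omega>) \<le> (\<Sum>f\<in>F0. w f * R f) \<and>
      (\<forall>g\<in>F0. (\<Sum>f\<in>F0. w f * A\<^sub>n \<omega> f) \<le> A\<^sub>n \<omega> g + ln (card F0) / n)"
      using pick[of "\<lambda>_. 1"] by (intro exI[of _ "\<lambda>f. if f = erm \<omega> then 1 else 0"]) (auto simp: pick)
  qed
qed

lemma hull_F: "convex hull F0 \<subseteq> F"
  using F0_F F_subspace by (intro hull_minimal subspace_imp_convex)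

text \<open>
  Convexity bounds the loss of a mixture above by integrable losses, and \<open>has_risk\<close> bounds it below.
  Hence mixtures of candidates compete with \<open>fstar\<close>, and the risk of the aggregate is finite.
\<close>
lemma loss_integrable_hull:
  assumes cvx: "AE z in \<pi>. convex_on F (Q z)" and h: "h \<in> convex hull F0"
  shows "integrable \<pi> (\<lambda>z. Q z h)"
proof -
  obtain u where u: "\<And>f. f \<in> F0 \<Longrightarrow> 0 \<le> u f" "sum u F0 = 1" "h = (\<Sum>f\<in>F0. u f *\<^sub>R f)"
    using h unfolding convex_hull_finite[OF F0_fin] by auto
  have hF: "h \<in> F" using h hull_F by auto
  show ?thesis
  proof (rule Bochner_Integration.integrable_bound)
    show "integrable \<pi> (\<lambda>z. max 0 (- Q z h) + (\<Sum>f\<in>F0. \<bar>u f * Q z f\<bar>))"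
      using F_risk[OF hF] loss_integrable by (auto simp: has_risk_def)
    show "(\<lambda>z. Q z h) \<in> borel_measurable \<pi>" using loss_measurable[OF hF] .
    show "AE z in \<pi>. norm (Q z h) \<le> norm (max 0 (- Q z h) + (\<Sum>f\<in>F0. \<bar>u f * Q z f\<bar>))"
      using cvx
    proof eventually_elim
      case (elim z)
      have "Q z h \<le> (\<Sum>f\<in>F0. u f * Q z f)"
        unfolding u(3) using u F0_F F0_fin F0_ne elim by (intro convex_on_sum[where C = F]) auto
      also have "\<dots> \<le> (\<Sum>f\<in>F0. \<bar>u f * Q z f\<bar>)" by (intro sum_mono) auto
      finally have "Q z h \<le> (\<Sum>f\<in>F0. \<bar>u f * Q z f\<bar>)" .
      moreover have "0 \<le> (\<Sum>f\<in>F0. \<bar>u f * Q z f\<bar>)" by (intro sum_nonneg) auto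
      ultimately show ?case by (simp add: max_def)
    qed
  qed
qed

lemma R_convex:
  assumes cvx: "AE z in \<pi>. convex_on F (Q z)"
  shows "convex_on (convex hull F0) R"
  unfolding convex_on_def
proof (intro conjI ballI allI impI)
  show "convex (convex hull F0)" by (rule convex_convex_hull)
  fix x y :: 'f and u v :: real
  assume xy: "x \<in> convex hull F0" "y \<in> convex hull F0" and uv: "0 \<le> u" "0 \<le> v" "u + v = 1"
  have m: "u *\<^sub>R x + v *\<^sub>R y \<in> convex hull F0"
    by (rule convexD[OF convex_convex_hull xy uv])
  note int = loss_integrable_hull[OF cvx]
  have "risk \<pi> Q (u *\<^sub>R x + v *\<^sub>R y) \<le> (\<integral>z. u * Q z x + v * Q z y \<partial>\<pi>)"
    unfolding risk_def
  proof (rule integral_mono_AE[OF int[OF m]])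
    show "AE z in \<pi>. Q z (u *\<^sub>R x + v *\<^sub>R y) \<le> u * Q z x + v * Q z y"
      using cvx by eventually_elim (use xy uv subsetD[OF hull_F] in \<open>simp add: convex_on_def\<close>)
  qed (use int xy in auto)
  also have "\<dots> = u * risk \<pi> Q x + v * risk \<pi> Q y"
    using int xy by (simp add: risk_def)
  finally have "R (u *\<^sub>R x + v *\<^sub>R y) \<le> u * risk \<pi> Q x + v * risk \<pi> Q y - (u + v) * risk \<pi> Q fstar"
    using uv by (simp add: excess_risk_def)
  then show "R (u *\<^sub>R x + v *\<^sub>R y) \<le> u * R x + v * R y"
    by (simp add: excess_risk_def algebra_simps)
qed

lemma empirical_risk_measurable: "f \<in> F0 \<Longrightarrow> (\<lambda>\<omega>. A\<^sub>n \<omega> f) \<in> borel_measurable P"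
  unfolding empirical_risk_def
  using measurable_compose[OF X_measurable loss_measurable] F0_F
  by (intro borel_measurable_times borel_measurable_sum) auto

lemma aew_bound:
  assumes cvx: "AE z in \<pi>. convex_on F (Q z)"
  shows "integrable P (\<lambda>\<omega>. R (aew Q n F0 (\<lambda>i. X i \<omega>)))"
    and "P.expectation (\<lambda>\<omega>. R (aew Q n F0 (\<lambda>i. X i \<omega>))) \<le> min_excess_risk \<pi> Q fstar F0
    + 4 * residual c K n (card F0) \<kappa> F0 \<pi> Q fstar"
proof -
  define w where "w \<omega> = aew_weight Q n F0 (\<lambda>i. X i \<omega>)" for \<omega>
  have Npos: "(\<Sum>g\<in>F0. exp (- real n * A\<^sub>n \<omega> g)) > 0" for \<omega>
    using F0_fin F0_ne by (intro sum_pos) auto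
  have w: "w \<omega> f > 0" for \<omega> f using Npos[of \<omega>] by (simp add: w_def aew_weight_def)
  have w1: "sum (w \<omega>) F0 = 1" for \<omega>
    using Npos[of \<omega>] by (simp add: w_def aew_weight_def flip: sum_divide_distrib)
  have aew: "aew Q n F0 (\<lambda>i. X i \<omega>) = (\<Sum>f\<in>F0. w \<omega> f *\<^sub>R f)" for \<omega>
    by (simp add: aew_def w_def)
  have hull: "aew Q n F0 (\<lambda>i. X i \<omega>) \<in> convex hull F0" for \<omega>
    unfolding aew convex_hull_finite[OF F0_fin] using w w1 by (auto intro!: exI[of _ "w \<omega>"] less_imp_le)
  have wm: "(\<lambda>\<omega>. w \<omega> f) \<in> borel_measurable P" if "f \<in> F0" for f
    unfolding w_def aew_weight_def using empirical_risk_measurable that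
    by (intro borel_measurable_divide borel_measurable_exp borel_measurable_sum borel_measurable_times) auto
  have meas: "(\<lambda>\<omega>. R (aew Q n F0 (\<lambda>i. X i \<omega>))) \<in> borel_measurable P"
    unfolding aew by (rule borel_measurable_convex_on_combination[OF F0_fin R_convex[OF cvx] wm w w1])
  show int: "integrable P (\<lambda>\<omega>. R (aew Q n F0 (\<lambda>i. X i \<omega>)))"
  proof (rule P.integrable_const_bound[OF _ meas, where B = "Max (R ` F0)"], rule AE_I2)
    fix \<omega>
    have "R (aew Q n F0 (\<lambda>i. X i \<omega>)) \<le> Max (R ` F0)"
      using convex_on_convex_hull_bound[OF R_convex[OF cvx], of "Max (R ` F0)"] hull F0_fin by auto
    moreover have "R (aew Q n F0 (\<lambda>i. X i \<omega>)) \<ge> 0"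
      using R_nonneg hull hull_F loss_integrable_hull[OF cvx] by blast
    ultimately show "norm (R (aew Q n F0 (\<lambda>i. X i \<omega>))) \<le> Max (R ` F0)" by simp
  qed
  show "P.expectation (\<lambda>\<omega>. R (aew Q n F0 (\<lambda>i. X i \<omega>))) \<le> min_excess_risk \<pi> Q fstar F0
    + 4 * residual c K n (card F0) \<kappa> F0 \<pi> Q fstar"
  proof (rule randomized_selection_bound[OF int])
    fix \<omega>
    have "R (aew Q n F0 (\<lambda>i. X i \<omega>)) \<le> (\<Sum>f\<in>F0. w \<omega> f * R f)"
      unfolding aew using w w1 F0_fin F0_ne
      by (intro convex_on_sum[OF _ _ R_convex[OF cvx]]) (auto intro: less_imp_le hull_inc)
    moreover have "(\<Sum>f\<in>F0. w \<omega> f * A\<^sub>n \<omega> f) \<le> A\<^sub>n \<omega> g + ln (card F0) / n" if "g \<in> F0" for g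
    proof -
      have "n * (\<Sum>f\<in>F0. w \<omega> f * A\<^sub>n \<omega> f) = (\<Sum>f\<in>F0. w \<omega> f * (n * A\<^sub>n \<omega> f))"
        by (simp add: sum_distrib_left mult.left_commute)
      also have "\<dots> \<le> n * A\<^sub>n \<omega> g + ln (card F0)"
        using gibbs_average_le[OF F0_fin that, of "\<lambda>f. n * A\<^sub>n \<omega> f"]
        by (simp add: w_def aew_weight_def)
      finally show ?thesis using n by (simp add: field_simps)
    qed
    ultimately show "\<exists>w. (\<forall>f\<in>F0. 0 \<le> w f) \<and> sum w F0 = 1 \<and>
      R (aew Q n F0 (\<lambda>i. X i \<omega>)) \<le> (\<Sum>f\<in>F0. w f * R f) \<and>
      (\<forall>g\<in>F0. (\<Sum>f\<in>F0. w f * A\<^sub>n \<omega> f) \<le> A\<^sub>n \<omega> g + ln (card F0) / n)"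
      using w w1 by (intro exI[of _ "w \<omega>"]) (auto intro: less_imp_le)
  qed
qed

end

theorem theorem1:
  fixes \<pi> :: "'z measure" and P :: "'w measure" and X :: "nat \<Rightarrow> 'w \<Rightarrow> 'z"
    and F F0 :: "'f :: real_algebra set" and Q :: "'z \<Rightarrow> 'f \<Rightarrow> real" and fstar :: 'f
    and \<kappa> c K :: real and n M :: nat
  assumes "prob_space \<pi>" and "prob_space P"
    and "n \<ge> 1"
    and iid: "prob_space.indep_vars P (\<lambda>_. \<pi>) X {1..n}"
             "\<And>i. i \<in> {1..n} \<Longrightarrow> distr P \<pi> (X i) = \<pi>"
    and algebra: "subspace F" "\<And>f g. f \<in> F \<Longrightarrow> g \<in> F \<Longrightarrow> f * g \<in> F"
    and "\<And>f. f \<in> F \<Longrightarrow> has_risk \<pi> Q f"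
    and "risk_minimizer \<pi> Q F fstar"
    and "F0 \<subseteq> F" and "finite F0" and "card F0 = M" and "M \<ge> 2"
    and "\<kappa> \<ge> 1" and "c > 0" and "margin_assumption \<pi> Q fstar \<kappa> c F0"
    and "K \<ge> 1" and "\<And>f. f \<in> F0 \<Longrightarrow> AE z in \<pi>. \<bar>Q z f - Q z fstar\<bar> \<le> K"
  shows "(\<forall>erm :: 'w \<Rightarrow> 'f.
            (\<forall>\<omega>\<in>space P. is_erm Q n F0 (\<lambda>i. X i \<omega>) (erm \<omega>)) \<longrightarrow>
            (\<lambda>\<omega>. risk \<pi> Q (erm \<omega>)) \<in> borel_measurable P \<longrightarrow>
            integrable P (\<lambda>\<omega>. excess_risk \<pi> Q fstar (erm \<omega>)) \<and>
            (\<integral>\<omega>. excess_risk \<pi> Q fstar (erm \<omega>) \<partial>P)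
              \<le> min_excess_risk \<pi> Q fstar F0 + 4 * residual c K n M \<kappa> F0 \<pi> Q fstar)
       \<and> ((AE z in \<pi>. convex_on F (Q z)) \<longrightarrow>
            integrable P (\<lambda>\<omega>. excess_risk \<pi> Q fstar (aew Q n F0 (\<lambda>i. X i \<omega>))) \<and>
            (\<integral>\<omega>. excess_risk \<pi> Q fstar (aew Q n F0 (\<lambda>i. X i \<omega>)) \<partial>P)
              \<le> min_excess_risk \<pi> Q fstar F0 + 4 * residual c K n M \<kappa> F0 \<pi> Q fstar)"
proof -
  interpret margin_aggregation P \<pi> X F F0 Q fstar \<kappa> c K n
    using assms by (simp add: margin_aggregation_def margin_aggregation_axioms_def)
  show ?thesis
    using erm_bound aew_bound \<open>card F0 = M\<close> by blast
qed

end
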